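(* (1) Let $C$ be a self-orthogonal $L$-code. Then $C$ is equivalent to $D\oplus\Gamma_1^{l}$ for some integer $l\geq 0$ and some $L$-code $D$ whose minimal Euclidean weight is strictly larger than $1$. (2) Let $C$ be a self-orthogonal $L$-code of minimal Euclidean weight $2$. Then the Euclidean weight-$2$-subcode of $C$ is equivalent to a direct sum of codes each of which is either $\Delta_l$ for some $l\geq 1$ or $\Xi_1$.
   Context: Let $L=\{0,1,\omega,\bar\omega\}$ be the Klein four-group $\mathbf{Z}_2\times\mathbf{Z}_2$. Define $|0|^2=0$, $|1|^2=1$, $|\omega|^2=|\bar\omega|^2=2$; the dot product $x\cdot y\in\mathbf{F}_2$ is $1$ iff $x,y$ are distinct and nonzero. On $L^n$: $(\mathbf{x},\mathbf{y})=\sum_i x_i\cdot y_i$, $\mathrm{ewt}(\mathbf{x})=\sum_i|x_i|^2$. An $L$-code of length $n$ is a subgroup $C\subseteq L^n$; it is self-orthogonal if $(\mathbf{x},\mathbf{y})=0$ for all $\mathbf{x},\mathbf{y}\in C$. Its minimal Euclidean weight is $\min\{\mathrm{ewt}(\mathbf{x}):\mathbf{x}\in C\setminus\{0\}\}$. The Euclidean weight-$2$-subcode of $C$ is the subgroup generated by all codewords of Euclidean weight at most $2$. The direct sum of $C\subseteq L^n$ and $D\subseteq L^m$ is $C\times D\subseteq L^{n+m}$; $C^l$ denotes the $l$-fold direct sum. The group $G=S_2^n{:}S_n$ acts on $L^n$ by permuting coordinates and independently interchanging $\omega,\bar\omega$ in each coordinate; codes in the same orbit are equivalent. Specific codes: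 $\Gamma_1=\{0,1\}\subseteq L^1$, $\Xi_1=\{0,\omega\}\subseteq L^1$, and $\Delta_l\subseteq L^l$ is the set of vectors all of whose coordinates lie in $\{0,1\}$ with an even number of coordinates equal to $1$ (so $\Delta_1=\{0\}$). *)

theory Defs
  imports "HOL-Algebra.Generated_Groups" "HOL-Combinatorics.Permutations"
    "HOL-Library.Z2" "HOL-Library.Product_Plus" "HOL-Library.Extended_Nat"
begin

text \<open>The Klein four-group is \<open>\<int>\<^sub>2 \<times> \<int>\<^sub>2\<close> with its componentwise addition. We take
  \<open>1 = (1,1)\<close>, so that \<open>\<omega>\<close> and its conjugate are the two unit vectors and
  \<open>1 + \<omega> = \<omega>'\<close>.\<close>

type_synonym klein = "bit \<times> bit"

abbreviation K1 :: klein where "K1 \<equiv> (1, 1)"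
abbreviation K\<omega> :: klein where "K\<omega> \<equiv> (1, 0)"
abbreviation K\<omega>' :: klein where "K\<omega>' \<equiv> (0, 1)"

definition norm2 :: "klein \<Rightarrow> nat" where
  "norm2 x = (if x = 0 then 0 else if x = K1 then 1 else 2)"

definition dot :: "klein \<Rightarrow> klein \<Rightarrow> bit" where
  "dot x y = (if x \<noteq> y \<and> x \<noteq> 0 \<and> y \<noteq> 0 then 1 else 0)"

definition interchange :: "klein \<Rightarrow> klein" where
  "interchange x = (if x = K\<omega> then K\<omega>' else if x = K\<omega>' then K\<omega> else x)"

text \<open>Vectors of \<open>L\<^sup>n\<close> are lists of length \<open>n\<close>, so that direct sums are given by
  concatenation.\<close>

definition Lpow :: "nat \<Rightarrow> klein list monoid" where
  "Lpow n = \<lparr>carrier = {x. length x = n}, monoid.mult = map2 (+), one = replicate n 0\<rparr>"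

lemma group_Lpow: "group (Lpow n)"
proof (rule groupI)
  fix x y z assume "x \<in> carrier (Lpow n)" "y \<in> carrier (Lpow n)" "z \<in> carrier (Lpow n)"
  then show "x \<otimes>\<^bsub>Lpow n\<^esub> y \<otimes>\<^bsub>Lpow n\<^esub> z = x \<otimes>\<^bsub>Lpow n\<^esub> (y \<otimes>\<^bsub>Lpow n\<^esub> z)"
    by (auto simp: Lpow_def add.assoc intro!: nth_equalityI)
next
  fix x assume x: "x \<in> carrier (Lpow n)"
  then show "\<one>\<^bsub>Lpow n\<^esub> \<otimes>\<^bsub>Lpow n\<^esub> x = x"
    by (auto simp: Lpow_def intro!: nth_equalityI)
  show "\<exists>y\<in>carrier (Lpow n). y \<otimes>\<^bsub>Lpow n\<^esub> x = \<one>\<^bsub>Lpow n\<^esub>"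
    using x by (intro bexI[of _ "map uminus x"]) (auto simp: Lpow_def intro!: nth_equalityI)
qed (auto simp: Lpow_def)

definition inner_L :: "klein list \<Rightarrow> klein list \<Rightarrow> bit" where
  "inner_L x y = (\<Sum>i<length x. dot (x ! i) (y ! i))"

definition ewt :: "klein list \<Rightarrow> nat" where
  "ewt x = (\<Sum>i<length x. norm2 (x ! i))"

definition L_code :: "nat \<Rightarrow> klein list set \<Rightarrow> bool" where
  "L_code n C \<longleftrightarrow> subgroup C (Lpow n)"

definition self_orthogonal :: "klein list set \<Rightarrow> bool" where
  "self_orthogonal C \<longleftrightarrow> (\<forall>x\<in>C. \<forall>y\<in>C. inner_L x y = 0)"

text \<open>The zero code has minimal Euclidean weight \<open>\<infinity>\<close>, the infimum of the empty set.\<close>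

definition min_ewt :: "nat \<Rightarrow> klein list set \<Rightarrow> enat" where
  "min_ewt n C = (INF x \<in> C - {\<one>\<^bsub>Lpow n\<^esub>}. enat (ewt x))"

definition weight2_subcode :: "nat \<Rightarrow> klein list set \<Rightarrow> klein list set" where
  "weight2_subcode n C = generate (Lpow n) {x \<in> C. ewt x \<le> 2}"

definition dsum :: "klein list set \<Rightarrow> klein list set \<Rightarrow> klein list set" (infixr "\<oplus>\<^sub>L" 65) where
  "C \<oplus>\<^sub>L D = {x @ y | x y. x \<in> C \<and> y \<in> D}"

text \<open>The empty direct sum is the unique code of length \<open>0\<close>.\<close>

definition dsum_list :: "klein list set list \<Rightarrow> klein list set" where
  "dsum_list Cs = foldr (\<oplus>\<^sub>L) Cs {[]}"

definition dsum_pow :: "klein list set \<Rightarrow> nat \<Rightarrow> klein list set" where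
  "dsum_pow C l = dsum_list (replicate l C)"

text \<open>The element of \<open>S\<^sub>2\<^sup>n : S\<^sub>n\<close> that permutes the coordinates by \<open>\<sigma>\<close> and then interchanges
  \<open>\<omega>\<close> and its conjugate in the coordinates belonging to \<open>S\<close>.\<close>

definition G_act :: "(nat \<Rightarrow> nat) \<Rightarrow> nat set \<Rightarrow> klein list \<Rightarrow> klein list" where
  "G_act \<sigma> S x = map (\<lambda>i. if i \<in> S then interchange (x ! \<sigma> i) else x ! \<sigma> i) [0..<length x]"

definition equivalent_codes :: "nat \<Rightarrow> klein list set \<Rightarrow> klein list set \<Rightarrow> bool" where
  "equivalent_codes n C D \<longleftrightarrow> (\<exists>\<sigma> S. \<sigma> permutes {..<n} \<and> S \<subseteq> {..<n} \<and> D = G_act \<sigma> S ` C)"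

definition Gamma1 :: "klein list set" where
  "Gamma1 = {[0], [K1]}"

definition Xi1 :: "klein list set" where
  "Xi1 = {[0], [K\<omega>]}"

definition Delta :: "nat \<Rightarrow> klein list set" where
  "Delta l = {x. length x = l \<and> set x \<subseteq> {0, K1} \<and> even (count_list x K1)}"

end

theory Submission
  imports Defs
begin

text \<open>If a multiple \<open>a e\<^sub>i\<close> of a unit vector lies in a self-orthogonal code, then every codeword has
  \<open>i\<close>-th entry \<open>0\<close> or \<open>a\<close>, so the coordinate \<open>i\<close> splits off. For \<open>a = 1\<close> this gives the summands
  \<open>\<Gamma>\<^sub>1\<close>, and for \<open>a = \<omega>\<close> or its conjugate the summands \<open>\<Xi>\<^sub>1\<close>. If no \<open>e\<^sub>i\<close> is a codeword, the other
  words of weight 2 are the \<open>e\<^sub>i + e\<^sub>j\<close>; on the coordinates not split off, \<open>e\<^sub>i + e\<^sub>j \<in> C\<close> is an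
  equivalence relation between \<open>i\<close> and \<open>j\<close>, and each class of size \<open>l\<close> gives a summand \<open>\<Delta>\<^sub>l\<close>.\<close>

section \<open>The Klein four-group and codes in its powers\<close>

lemma klein_cases:
  obtains "x = (0 :: klein)" | "x = K1" | "x = K\<omega>" | "x = K\<omega>'"
  by (cases x; cases "fst x"; cases "snd x") (auto simp: zero_prod_def)

lemma klein_add_self [simp]: "x + x = (0 :: klein)"
  by (simp add: prod_eq_iff)

lemma norm2_eq_0_iff [simp]: "norm2 x = 0 \<longleftrightarrow> x = 0"
  by (simp add: norm2_def)

lemma norm2_zero [simp]: "norm2 0 = 0"
  by (simp add: norm2_def)

lemma norm2_eq_1_iff: "norm2 x = Suc 0 \<longleftrightarrow> x = K1"
  by (simp add: norm2_def zero_prod_def)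

lemma norm2_eq_2_iff: "norm2 x = 2 \<longleftrightarrow> x = K\<omega> \<or> x = K\<omega>'"
  by (cases x rule: klein_cases) (auto simp: norm2_def zero_prod_def)

lemma norm2_le_2: "norm2 x \<le> 2"
  by (simp add: norm2_def)

lemma interchange_interchange [simp]: "interchange (interchange x) = x"
  by (auto simp: interchange_def)

lemma Lpow_simps [simp]:
  "x \<in> carrier (Lpow n) \<longleftrightarrow> length x = n"
  "x \<otimes>\<^bsub>Lpow n\<^esub> y = map2 (+) x y"
  "\<one>\<^bsub>Lpow n\<^esub> = replicate n 0"
  by (auto simp: Lpow_def)

lemma inv_Lpow: "length x = n \<Longrightarrow> inv\<^bsub>Lpow n\<^esub> x = x"
  by (rule group.inv_equality[OF group_Lpow]) (auto intro: nth_equalityI)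

lemma L_codeI:
  assumes "\<And>x. x \<in> C \<Longrightarrow> length x = n" "replicate n 0 \<in> C"
    and "\<And>x y. x \<in> C \<Longrightarrow> y \<in> C \<Longrightarrow> map2 (+) x y \<in> C"
  shows "L_code n C"
  unfolding L_code_def by (rule subgroup.intro) (use assms in \<open>auto simp: inv_Lpow\<close>)

lemma
  assumes "L_code n C"
  shows L_code_length: "x \<in> C \<Longrightarrow> length x = n"
    and L_code_zero: "replicate n 0 \<in> C"
    and L_code_add: "x \<in> C \<Longrightarrow> y \<in> C \<Longrightarrow> map2 (+) x y \<in> C"
  using subgroup.subset[of C "Lpow n"] subgroup.one_closed[of C "Lpow n"]
    subgroup.m_closed[of C "Lpow n"] assms
  by (auto simp: L_code_def)

section \<open>Direct sums over blocks of coordinates, and equivalence\<close>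

lemma dsum_list_simps [simp]:
  "dsum_list [] = {[]}"
  "dsum_list (E # Es) = E \<oplus>\<^sub>L dsum_list Es"
  by (simp_all add: dsum_list_def)

lemma length_dsum_list:
  assumes "list_all2 (\<lambda>B E. \<forall>y\<in>E. length y = length B) Bs Es" "y \<in> dsum_list Es"
  shows "length y = length (concat Bs)"
  using assms by (induction arbitrary: y rule: list_all2_induct) (auto simp: dsum_def)

text \<open>All words of a summand have the length of its block, so a concatenation can be cut only
  at the block boundaries, and membership is tested block by block.\<close>

lemma map_concat_in_dsum_list_iff:
  assumes "list_all2 (\<lambda>B E. \<forall>y\<in>E. length y = length B) Bs Es"
  shows "map f (concat Bs) \<in> dsum_list Es \<longleftrightarrow> list_all2 (\<lambda>B E. map f B \<in> E) Bs Es"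
  using assms
proof (induction rule: list_all2_induct)
  case (Cons B Bs E Es)
  have "map f B @ map f (concat Bs) \<in> E \<oplus>\<^sub>L dsum_list Es \<longleftrightarrow>
      map f B \<in> E \<and> map f (concat Bs) \<in> dsum_list Es"
    using Cons.hyps by (fastforce simp: dsum_def append_eq_append_conv)
  then show ?case
    using Cons.IH by simp
qed auto

text \<open>The blocks list the coordinates in their new order; \<open>T\<close> consists of the coordinates, in the
  old numbering, in which \<open>\<omega>\<close> and its conjugate are interchanged.\<close>

lemma equivalent_codes_dsum_listI:
  assumes Bs: "distinct (concat Bs)" "set (concat Bs) = {..<n}"
    and len: "list_all2 (\<lambda>B E. \<forall>y\<in>E. length y = length B) Bs Es"
    and C: "\<And>x. x \<in> C \<longleftrightarrow> length x = n \<and>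
      list_all2 (\<lambda>B E. map (\<lambda>j. if j \<in> T then interchange (x ! j) else x ! j) B \<in> E) Bs Es"
  shows "equivalent_codes n C (dsum_list Es)"
proof -
  define p where "p = concat Bs"
  define \<sigma> where "\<sigma> i = (if i < n then p ! i else i)" for i
  define \<phi> where "\<phi> x j = (if j \<in> T then interchange (x ! j) else x ! j)" for x j
  \<comment> \<open>\<open>G_act\<close> permutes first and interchanges afterwards, so its set
    refers to new positions: position \<open>i\<close> carries the old coordinate
    \<open>p ! i\<close>.\<close>
  define S where "S = {i. i < n \<and> p ! i \<in> T}"
  have p: "distinct p" "set p = {..<n}" using Bs by (simp_all add: p_def)
  have len_p: "length p = n"
    using distinct_card[OF p(1)] p(2) by simp
  have bij: "bij_betw ((!) p) {..<n} {..<n}"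
    using bij_betw_nth[OF p(1) len_p[symmetric, THEN arg_cong[where f=lessThan]]] p(2) by simp
  have \<sigma>: "\<sigma> permutes {..<n}"
  proof (rule bij_imp_permutes)
    show "bij_betw \<sigma> {..<n} {..<n}"
      using bij by (rule bij_betw_cong[THEN iffD1, rotated]) (simp add: \<sigma>_def)
  qed (simp add: \<sigma>_def)
  have act: "G_act \<sigma> S x = map (\<phi> x) p" if "length x = n" for x
    using that by (auto simp: G_act_def \<phi>_def S_def \<sigma>_def len_p intro!: nth_equalityI)
  have mem: "x \<in> C \<longleftrightarrow> length x = n \<and> map (\<phi> x) p \<in> dsum_list Es" for x
    unfolding p_def map_concat_in_dsum_list_iff[OF len] by (simp add: C \<phi>_def [abs_def])
  have "dsum_list Es = G_act \<sigma> S ` C"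
  proof (intro equalityI subsetI)
    fix y assume y: "y \<in> dsum_list Es"
    then have len_y: "length y = n"
      using length_dsum_list[OF len y] len_p by (simp add: p_def)
    define q where "q = inv_into {..<n} ((!) p)"
    \<comment> \<open>The preimage of \<open>y\<close>: each entry is moved back to its old
      coordinate, and applying \<open>interchange\<close> again on \<open>T\<close> undoes it, as it
      is an involution.\<close>
    define x where
      "x = map (\<lambda>j. if j \<in> T then interchange (y ! q j) else y ! q j) [0..<n]"
    have "q (p ! i) = i" if "i < n" for i
      using that bij by (simp add: q_def bij_betw_inv_into_left)
    moreover have "p ! i < n" if "i < n" for i
      using that p(2) len_p nth_mem[of i p] by auto
    ultimately have "map (\<phi> x) p = y"
      using len_y len_p by (auto simp: x_def \<phi>_def len_y len_p intro!: nth_equalityI)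
    moreover have "length x = n" by (simp add: x_def)
    ultimately show "y \<in> G_act \<sigma> S ` C"
      using y mem act by (metis image_eqI)
  qed (use mem act in auto)
  moreover have "S \<subseteq> {..<n}" by (auto simp: S_def)
  ultimately show ?thesis
    using \<sigma> by (auto simp: equivalent_codes_def)
qed

section \<open>Unit vectors, supports and codes spanned by sparse words\<close>

definition unit_vec :: "nat \<Rightarrow> nat \<Rightarrow> klein \<Rightarrow> klein list" where
  "unit_vec n i a = (replicate n 0)[i := a]"

lemma length_unit_vec [simp]: "length (unit_vec n i a) = n"
  by (simp add: unit_vec_def)

lemma nth_unit_vec [simp]: "j < n \<Longrightarrow> unit_vec n i a ! j = (if j = i then a else 0)"
  by (simp add: unit_vec_def nth_list_update)

text \<open>In this form \<open>pair_vec n i i\<close> is the zero word, and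
  \<open>pair_vec n i j\<close> and \<open>pair_vec n j k\<close> add up to
  \<open>pair_vec n i k\<close>. This makes the pairs lying in a code an equivalence
  relation.\<close>

abbreviation pair_vec :: "nat \<Rightarrow> nat \<Rightarrow> nat \<Rightarrow> klein list" where
  "pair_vec n i j \<equiv> map2 (+) (unit_vec n i K1) (unit_vec n j K1)"

definition supp :: "klein list \<Rightarrow> nat set" where
  "supp x = {i. i < length x \<and> x ! i \<noteq> 0}"

lemma finite_supp [simp]: "finite (supp x)"
  by (simp add: supp_def)

text \<open>Induction on the size of the support: \<open>x + g\<close> lies in \<open>W\<close> by
  induction, and \<open>x = (x + g) + g\<close> because every element is its own negative. It serves
  to show that an explicitly described set of words is spanned by words of small weight.\<close>

lemma subset_L_code_if_descent:
  assumes W: "L_code n W"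
    and len: "\<And>x. x \<in> R \<Longrightarrow> length x = n"
    and step: "\<And>x i. x \<in> R \<Longrightarrow> i < n \<Longrightarrow> x ! i \<noteq> 0 \<Longrightarrow>
      \<exists>g\<in>W. map2 (+) x g \<in> R \<and> supp (map2 (+) x g) \<subset> supp x"
  shows "R \<subseteq> W"
proof
  fix x assume "x \<in> R"
  then show "x \<in> W"
  proof (induction "card (supp x)" arbitrary: x rule: less_induct)
    case less
    show ?case
    proof (cases "\<exists>i<n. x ! i \<noteq> 0")
      case True
      then obtain g where g: "g \<in> W" "map2 (+) x g \<in> R" "supp (map2 (+) x g) \<subset> supp x"
        using step less.prems by blast
      then have "map2 (+) x g \<in> W"
        by (intro less.hyps) (auto intro: psubset_card_mono)
      then have "map2 (+) (map2 (+) x g) g \<in> W"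
        using W g(1) by (auto intro: L_code_add[of n])
      also have "map2 (+) (map2 (+) x g) g = x"
        using len[OF less.prems] L_code_length[OF W g(1)]
        by (auto simp: add.assoc intro!: nth_equalityI)
      finally show ?thesis .
    next
      case False
      then have "x = replicate n 0"
        using len[OF less.prems] by (auto intro: nth_equalityI)
      then show ?thesis using L_code_zero[OF W] by simp
    qed
  qed
qed

text \<open>Only the \<open>i\<close>-th term of the inner product with the unit vector survives,
  and \<open>dot a (x ! i) = 0\<close> with \<open>a\<close> nonzero leaves just these two
  values.\<close>

lemma self_orthogonal_nth:
  assumes C: "L_code n C" "self_orthogonal C"
    and "unit_vec n i a \<in> C" "x \<in> C" "i < n" "a \<noteq> 0"
  shows "x ! i = 0 \<or> x ! i = a"
proof -
  have "inner_L (unit_vec n i a) x = (\<Sum>j<n. if j = i then dot a (x ! j) else 0)"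
    unfolding inner_L_def by (rule sum.cong) (auto simp: dot_def)
  also have "\<dots> = dot a (x ! i)"
    using \<open>i < n\<close> by simp
  finally have "dot a (x ! i) = 0"
    using assms by (simp add: self_orthogonal_def)
  then show ?thesis using \<open>a \<noteq> 0\<close> by (auto simp: dot_def split: if_splits)
qed

section \<open>Words of Euclidean weight at most 2\<close>

lemma ewt_remove:
  assumes "i < length x"
  shows "ewt x = norm2 (x ! i) + (\<Sum>j\<in>{..<length x} - {i}. norm2 (x ! j))"
  unfolding ewt_def using assms by (intro sum.remove) auto

text \<open>Every nonzero entry contributes at least 1, so there are at most two of them; if there
  are two, each contributes exactly 1 and hence equals \<open>K1\<close>.\<close>

lemma ewt_le_2_cases:
  assumes "ewt x \<le> 2" and n: "length x = n"
  obtains (zero) "x = replicate n 0"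
    | (K1) i where "i < n" "x = unit_vec n i K1"
    | (norm2) i a where "i < n" "norm2 a = 2" "x = unit_vec n i a"
    | (pair) i j where "i < n" "j < n" "i \<noteq> j" "x = pair_vec n i j"
proof (cases "\<exists>i<n. x ! i \<noteq> 0")
  case False
  then show thesis using n by (intro zero) (auto intro: nth_equalityI)
next
  case True
  then obtain i where i: "i < n" "x ! i \<noteq> 0" by blast
  have ewt: "ewt x = norm2 (x ! i) + (\<Sum>k\<in>{..<n} - {i}. norm2 (x ! k))"
    using ewt_remove[of i x] i n by simp
  show thesis
  proof (cases "\<exists>j<n. j \<noteq> i \<and> x ! j \<noteq> 0")
    case False
    then have x: "x = unit_vec n i (x ! i)"
      using n by (auto intro!: nth_equalityI)
    have "norm2 (x ! i) \<noteq> 0" using i by simp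
    then consider "norm2 (x ! i) = 1" | "norm2 (x ! i) = 2"
      using norm2_le_2[of "x ! i"] by linarith
    then show thesis
      using i x K1 norm2 by cases (auto simp: norm2_eq_1_iff)
  next
    case True
    then obtain j where j: "j < n" "j \<noteq> i" "x ! j \<noteq> 0" by blast
    have "(\<Sum>k\<in>{..<n} - {i}. norm2 (x ! k)) =
        norm2 (x ! j) + (\<Sum>k\<in>{..<n} - {i} - {j}. norm2 (x ! k))"
      using j by (intro sum.remove) auto
    moreover have "norm2 (x ! i) \<noteq> 0" "norm2 (x ! j) \<noteq> 0" using i j by simp_all
    ultimately have "norm2 (x ! i) = 1" "norm2 (x ! j) = 1"
        "(\<Sum>k\<in>{..<n} - {i} - {j}. norm2 (x ! k)) = 0"
      using ewt assms(1) by linarith+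
    then have "x = pair_vec n i j"
      using n i j by (auto simp: norm2_eq_1_iff intro!: nth_equalityI)
    then show thesis using i j pair by blast
  qed
qed

lemma ewt_map: "distinct xs \<Longrightarrow> ewt (map f xs) = (\<Sum>i\<in>set xs. norm2 (f i))"
  by (simp add: ewt_def sum_list_distinct_conv_sum_set[symmetric] sum_list_sum_nth atLeast0LessThan)

lemma ewt_unit_vec: "i < n \<Longrightarrow> ewt (unit_vec n i a) = norm2 a"
  using ewt_remove[of i "unit_vec n i a"] by simp

lemma ewt_pair_vec:
  assumes "i < n" "j < n" "i \<noteq> j"
  shows "ewt (pair_vec n i j) = 2"
proof -
  have "ewt (pair_vec n i j) = (\<Sum>k<n. (if k = i then 1 else 0) + (if k = j then 1 else 0))"
    unfolding ewt_def using assms by (intro sum.cong) (auto simp: norm2_def zero_prod_def)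
  also have "\<dots> = 2"
    using assms by (simp add: sum.distrib)
  finally show ?thesis .
qed

lemma min_ewt_le: "x \<in> C \<Longrightarrow> x \<noteq> replicate n 0 \<Longrightarrow> min_ewt n C \<le> enat (ewt x)"
  unfolding min_ewt_def by (intro INF_lower) simp

text \<open>The premise holds vacuously for the zero code, whose minimal weight is infinite.\<close>

lemma min_ewt_gr_1I:
  assumes "\<And>x. x \<in> C \<Longrightarrow> x \<noteq> replicate n 0 \<Longrightarrow> ewt x \<ge> 2"
  shows "min_ewt n C > 1"
proof -
  have "enat 2 \<le> min_ewt n C"
    unfolding min_ewt_def by (intro INF_greatest) (use assms in auto)
  then show ?thesis
    by (rule less_le_trans[rotated]) (simp add: one_enat_def)
qed

text \<open>Since \<open>K1 + K1 = 0\<close>, the sum of entries from \<open>{0, K1}\<close> records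
  exactly the parity of the number of \<open>K1\<close>s. The additive form is independent of the
  order of coordinates and compatible with adding words.\<close>

lemma in_Delta_iff:
  assumes "distinct B"
  shows "map f B \<in> Delta (length B) \<longleftrightarrow> (\<forall>i\<in>set B. f i \<in> {0, K1}) \<and> (\<Sum>i\<in>set B. f i) = 0"
proof -
  have "sum_list y = (if even (count_list y K1) then 0 else K1)" if "set y \<subseteq> {0, K1}" for y
    using that by (induction y) (auto simp: zero_prod_def)
  moreover have "(\<Sum>i\<in>set B. f i) = sum_list (map f B)"
    using assms by (simp add: sum_list_distinct_conv_sum_set)
  ultimately have sum: "sum f (set B) = (if even (count_list (map f B) K1) then 0 else K1)"
    if "\<forall>i\<in>set B. f i \<in> {0, K1}"
    using that by (metis image_subsetI set_map)
  have "K1 \<noteq> 0" by (simp add: zero_prod_def)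
  show ?thesis
  proof (cases "\<forall>i\<in>set B. f i \<in> {0, K1}")
    case True
    then show ?thesis
      using sum[OF True] \<open>K1 \<noteq> 0\<close> by (simp add: Delta_def image_subset_iff)
  next
    case False
    then show ?thesis by (auto simp: Delta_def)
  qed
qed

text \<open>Adding \<open>g\<close> cancels the entry at \<open>i\<close>, and no new nonzero entry
  arises because \<open>g\<close> is supported inside the support of \<open>x\<close>.\<close>

lemma supp_add_psubset:
  assumes "length x = n" "length g = n" "i < n" "x ! i \<noteq> 0" "x ! i = g ! i"
    and "\<And>j. j < n \<Longrightarrow> g ! j \<noteq> 0 \<Longrightarrow> x ! j \<noteq> 0"
  shows "supp (map2 (+) x g) \<subset> supp x"
proof -
  have "supp (map2 (+) x g) \<subseteq> supp x"
  proof
    fix j assume j: "j \<in> supp (map2 (+) x g)"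
    then have "j < n" "x ! j + g ! j \<noteq> 0"
      using assms(1,2) by (auto simp: supp_def)
    then show "j \<in> supp x"
      using assms(1) assms(6)[of j] by (cases "g ! j = 0") (simp_all add: supp_def)
  qed
  moreover have "i \<in> supp x - supp (map2 (+) x g)"
    using assms by (simp add: supp_def)
  ultimately show ?thesis by blast
qed

section \<open>Splitting off the summands \<open>Gamma1\<close>\<close>

text \<open>\<open>D\<close> is the projection of \<open>C\<close> to the coordinates outside
  \<open>A\<close>. All words supported on \<open>A\<close> with entries in \<open>{0, K1}\<close>
  are codewords, so the \<open>A\<close>-part of any codeword can be added to it without leaving
  \<open>C\<close>; hence \<open>C\<close> is the direct sum of \<open>D\<close> and this
  part.\<close>

lemma self_orthogonal_split_Gamma1:
  assumes C: "L_code n C" "self_orthogonal C"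
  obtains l m D where "L_code m D" "min_ewt m D > 1"
    "equivalent_codes n C (D \<oplus>\<^sub>L dsum_pow Gamma1 l)"
proof -
  define A where "A = {i. i < n \<and> unit_vec n i K1 \<in> C}"
  define As where "As = sorted_list_of_set A"
  define B where "B = sorted_list_of_set ({..<n} - A)"
  define D where "D = (\<lambda>x. map ((!) x) B) ` C"
  have As: "distinct As" "set As = A" and B: "distinct B" "set B = {..<n} - A"
    by (simp_all add: As_def B_def A_def)
  have nth_A: "x ! i = 0 \<or> x ! i = K1" if "x \<in> C" "i \<in> A" for x i
    using self_orthogonal_nth[OF C, of i K1 x] that by (auto simp: A_def zero_prod_def)
  have sub: "{z. length z = n \<and> (\<forall>i<n. z ! i = 0 \<or> i \<in> A \<and> z ! i = K1)} \<subseteq> C" (is "?R \<subseteq> C")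
  proof (rule subset_L_code_if_descent[OF C(1)])
    fix z i assume z: "z \<in> ?R" "i < n" "z ! i \<noteq> 0"
    then have "i \<in> A" "z ! i = K1" by auto
    then show "\<exists>g\<in>C. map2 (+) z g \<in> ?R \<and> supp (map2 (+) z g) \<subset> supp z"
      using z by (intro bexI[of _ "unit_vec n i K1"] conjI supp_add_psubset[of _ n _ i])
        (auto simp: A_def split: if_splits)
  qed simp
  have "L_code (length B) D"
  proof (rule L_codeI)
    have "map ((!) (replicate n 0)) B = map (\<lambda>_. 0) B"
      by (rule map_cong) (use B(2) in auto)
    then show "replicate (length B) 0 \<in> D"
      using L_code_zero[OF C(1)] unfolding D_def
      by (metis image_eqI map_replicate_const)
    fix x y assume "x \<in> D" "y \<in> D"
    then obtain x' y' where
      xy: "x' \<in> C" "y' \<in> C" "x = map ((!) x') B" "y = map ((!) y') B"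
      by (auto simp: D_def)
    then have len: "length x' = n" "length y' = n"
      using L_code_length[OF C(1)] by simp_all
    have "map2 (+) x y = map (\<lambda>i. x' ! i + y' ! i) B"
      by (simp add: xy map2_map_map)
    also have "\<dots> = map ((!) (map2 (+) x' y')) B"
      by (rule map_cong) (use B(2) len in auto)
    finally show "map2 (+) x y \<in> D"
      using L_code_add[OF C(1) xy(1,2)] unfolding D_def by blast
  qed (auto simp: D_def)
  moreover have "min_ewt (length B) D > 1"
  proof (rule min_ewt_gr_1I)
    fix y assume y: "y \<in> D" "y \<noteq> replicate (length B) 0"
    then obtain x where x: "x \<in> C" "y = map ((!) x) B" by (auto simp: D_def)
    have len: "length x = n" using L_code_length[OF C(1)] x by simp
    \<comment> \<open>\<open>z\<close> is the \<open>A\<close>-part of \<open>x\<close>. It is a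
      codeword by \<open>sub\<close>, so \<open>w = x + z\<close> is a codeword that vanishes on
      \<open>A\<close> and has the same weight as its projection \<open>y\<close>.\<close>
    define z where "z = map (\<lambda>i. if i \<in> A then x ! i else 0) [0..<n]"
    define w where "w = map2 (+) x z"
    have "z \<in> ?R" using nth_A[OF x(1)] by (auto simp: z_def)
    then have "z \<in> C" using sub by blast
    then have w: "w \<in> C" using x L_code_add[OF C(1)] by (simp add: w_def)
    have w_nth: "w ! i = (if i \<in> A then 0 else x ! i)" if "i < n" for i
      using that len by (simp add: w_def z_def)
    have len_w: "length w = n" using w L_code_length[OF C(1)] by simp
    have y_eq: "y = map ((!) w) B"
      unfolding x(2) by (rule map_cong) (use B(2) w_nth in auto)
    have "ewt y = (\<Sum>i<n. norm2 (w ! i))"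
      unfolding y_eq ewt_map[OF B(1)] B(2) using w_nth
      by (intro sum.mono_neutral_left) auto
    then have ewt: "ewt y = ewt w" by (simp add: ewt_def len_w)
    show "ewt y \<ge> 2"
    proof (rule ccontr)
      assume "\<not> ewt y \<ge> 2"
      then have "ewt w \<le> 2" "\<not> ewt w \<ge> 2" using ewt by simp_all
      from this(1) len_w show False
      \<comment> \<open>\<open>w = 0\<close> would make \<open>y\<close> zero; a unit vector with
        entry \<open>K1\<close> would put its coordinate into \<open>A\<close>, where
        \<open>w\<close> vanishes; the remaining shapes have weight 2.\<close>
      proof (cases rule: ewt_le_2_cases)
        case zero
        have "map ((!) w) B = map (\<lambda>_. 0) B"
          unfolding zero by (rule map_cong) (use B(2) in auto)
        then show False using y(2) by (simp add: y_eq map_replicate_const)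
      next
        case (K1 i)
        then have "i \<in> A" using w by (simp add: A_def)
        then show False using w_nth[of i] K1 by (simp add: zero_prod_def)
      qed (use \<open>\<not> ewt w \<ge> 2\<close> in \<open>auto simp: ewt_unit_vec ewt_pair_vec\<close>)
    qed
  qed
  moreover have "equivalent_codes n C (dsum_list (D # map (\<lambda>_. Gamma1) As))"
  proof (rule equivalent_codes_dsum_listI[where T = "{}" and Bs = "B # map (\<lambda>i. [i]) As"])
    fix x
    \<comment> \<open>Outside \<open>A\<close>, \<open>x\<close> agrees with some codeword
      \<open>x'\<close>, so \<open>x + x'\<close> is supported on \<open>A\<close> with entries in
      \<open>{0, K1}\<close> and lies in \<open>C\<close>; adding \<open>x'\<close> once more
      recovers \<open>x\<close>.\<close>
    have "x \<in> C" if x: "length x = n" "map ((!) x) B \<in> D" "\<forall>i\<in>A. x ! i = 0 \<or> x ! i = K1"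
    proof -
      obtain x' where x': "x' \<in> C" "map ((!) x) B = map ((!) x') B"
        using x(2) by (auto simp: D_def)
      have len: "length x' = n" using x' L_code_length[OF C(1)] by simp
      have "x ! i + x' ! i = 0 \<or> i \<in> A \<and> x ! i + x' ! i = K1" if "i < n" for i
      proof (cases "i \<in> A")
        case True
        then show ?thesis using x(3) nth_A[OF x'(1) True] by auto
      next
        case False
        then have "x ! i = x' ! i" using x'(2) B(2) that by simp
        then show ?thesis by simp
      qed
      then have "map2 (+) x x' \<in> ?R"
        using x(1) len by simp
      then have "map2 (+) (map2 (+) x x') x' \<in> C"
        using sub L_code_add[OF C(1)] x'(1) by blast
      also have "map2 (+) (map2 (+) x x') x' = x"
        using x(1) len by (auto simp: add.assoc intro!: nth_equalityI)
      finally show "x \<in> C" .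
    qed
    then show "x \<in> C \<longleftrightarrow> length x = n \<and>
      list_all2 (\<lambda>B E. map (\<lambda>j. if j \<in> {} then interchange (x ! j) else x ! j) B \<in> E)
        (B # map (\<lambda>i. [i]) As) (D # map (\<lambda>_. Gamma1) As)"
      using L_code_length[OF C(1)] nth_A[of x]
      by (auto simp: list_all2_map1 list_all2_map2 list_all2_same As Gamma1_def D_def)
  qed (use As B in \<open>auto simp: list_all2_map1 list_all2_map2 list_all2_same D_def Gamma1_def A_def\<close>)
  ultimately show thesis
    using that by (simp add: map_replicate_const dsum_pow_def)
qed

section \<open>Decomposition of the weight-2-subcode\<close>

text \<open>The subcode \<open>W\<close> is shown to equal the explicit code \<open>R\<close>, from
  which the summands can be read off. One inclusion is checked on the generators, the other follows
  by descent on the support.\<close>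

lemma weight2_subcode_equivalent_dsum_list:
  assumes C: "L_code n C" "self_orthogonal C" and min: "min_ewt n C = 2"
  obtains Ds where "\<forall>E\<in>set Ds. (\<exists>l\<ge>1. E = Delta l) \<or> E = Xi1"
    "equivalent_codes n (weight2_subcode n C) (dsum_list Ds)"
proof -
  define A where "A = {i. i < n \<and> (unit_vec n i K\<omega> \<in> C \<or> unit_vec n i K\<omega>' \<in> C)}"
  \<comment> \<open>Here the codeword has entry \<open>K\<omega>'\<close>, so these coordinates must
    be interchanged to yield \<open>Xi1\<close>, which is built with
    \<open>K\<omega>\<close>.\<close>
  define T where "T = {i. i < n \<and> unit_vec n i K\<omega>' \<in> C}"
  define a where "a i = (if i \<in> T then K\<omega>' else K\<omega>)" for i
  define N where "N = {..<n} - A"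
  \<comment> \<open>A coordinate of \<open>N\<close> that occurs in no pair codeword forms a class
    of its own and later contributes \<open>Delta 1\<close>, the zero code of length 1, so that the
    blocks cover all \<open>n\<close> coordinates.\<close>
  define r where "r = {(i, j). i \<in> N \<and> j \<in> N \<and> pair_vec n i j \<in> C}"
  define R where "R = {x. length x = n \<and> (\<forall>i\<in>A. x ! i \<in> {0, a i}) \<and>
    (\<forall>X\<in>N // r. (\<forall>i\<in>X. x ! i \<in> {0, K1}) \<and> (\<Sum>i\<in>X. x ! i) = 0)}"
  define W where "W = weight2_subcode n C"
  have a: "a i \<noteq> 0" "unit_vec n i (a i) \<in> C" if "i \<in> A" for i
    using that by (auto simp: a_def A_def T_def zero_prod_def)
  have nth_A: "x ! i = 0 \<or> x ! i = a i" if "x \<in> C" "i \<in> A" for x i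
    using self_orthogonal_nth[OF C a(2) that(1)] a(1) that by (auto simp: A_def)
  \<comment> \<open>Minimal weight 2 enters here, excluding codewords of weight 1.\<close>
  have no_K1: "unit_vec n i K1 \<notin> C" if "i < n" for i
  proof
    assume "unit_vec n i K1 \<in> C"
    moreover have "unit_vec n i K1 \<noteq> replicate n 0"
      using that by (metis nth_replicate nth_unit_vec fst_conv fst_zero zero_neq_one)
    ultimately have "2 \<le> enat (ewt (unit_vec n i K1))"
      using min min_ewt_le by metis
    then show False
      using that by (simp add: ewt_unit_vec norm2_def zero_prod_def numeral_eq_enat)
  qed
  have equiv: "equiv N r"
  proof (rule equivI)
    have "pair_vec n i i = replicate n 0" for i
      by (auto intro!: nth_equalityI)
    then show "refl_on N r"
      using L_code_zero[OF C(1)] by (auto simp: refl_on_def r_def)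
    have "pair_vec n i j = pair_vec n j i" for i j
      by (auto intro!: nth_equalityI)
    then show "sym r"
      by (auto simp: sym_def r_def)
    have "map2 (+) (pair_vec n i j) (pair_vec n j k) = pair_vec n i k" for i j k
      by (auto intro!: nth_equalityI)
    then show "trans r"
      using L_code_add[OF C(1)] unfolding trans_def r_def by (auto, metis)
  qed (auto simp: r_def)
  have classes: "X \<subseteq> N" "X \<noteq> {}" "finite X" if "X \<in> N // r" for X
    using that in_quotient_imp_subset[OF equiv that] in_quotient_imp_non_empty[OF equiv that]
    by (auto simp: N_def intro: finite_subset)
  have same_class: "i \<in> X \<longleftrightarrow> j \<in> X" if "X \<in> N // r" "(i, j) \<in> r" for X i j
    using that equiv in_quotient_imp_closed symD[of r] by (metis equivE)
  have in_class: "\<exists>X\<in>N // r. i \<in> X" if "i \<in> N" for i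
    using that Union_quotient[OF equiv] by blast
  have class_less: "i < n" if "i \<in> X" "X \<in> N // r" for i X
    using that classes(1) by (auto simp: N_def)
  have R_D: "length x = n" "\<And>i. i \<in> A \<Longrightarrow> x ! i = 0 \<or> x ! i = a i"
    "\<And>X i. X \<in> N // r \<Longrightarrow> i \<in> X \<Longrightarrow> x ! i = 0 \<or> x ! i = K1"
    "\<And>X. X \<in> N // r \<Longrightarrow> (\<Sum>i\<in>X. x ! i) = 0" if "x \<in> R" for x
    using that unfolding R_def by blast+
  have R_I: "x \<in> R" if "length x = n" "\<And>i. i \<in> A \<Longrightarrow> x ! i = 0 \<or> x ! i = a i"
    "\<And>X i. X \<in> N // r \<Longrightarrow> i \<in> X \<Longrightarrow> x ! i = 0 \<or> x ! i = K1"
    "\<And>X. X \<in> N // r \<Longrightarrow> (\<Sum>i\<in>X. x ! i) = 0" for x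
    using that unfolding R_def by blast
  have R_code: "L_code n R"
  proof (rule L_codeI)
    show "replicate n 0 \<in> R"
      using class_less by (intro R_I sum.neutral) (auto simp: A_def)
    fix x y assume x: "x \<in> R" and y: "y \<in> R"
    have nth: "map2 (+) x y ! i = x ! i + y ! i" if "i < n" for i
      using that R_D(1)[OF x] R_D(1)[OF y] by simp
    show "map2 (+) x y \<in> R"
    proof (rule R_I)
      show "length (map2 (+) x y) = n"
        using R_D(1)[OF x] R_D(1)[OF y] by simp
    next
      fix i assume i: "i \<in> A"
      then show "map2 (+) x y ! i = 0 \<or> map2 (+) x y ! i = a i"
        using R_D(2)[OF x i] R_D(2)[OF y i] nth[of i] by (auto simp: A_def)
    next
      fix X i assume X: "X \<in> N // r" "i \<in> X"
      then show "map2 (+) x y ! i = 0 \<or> map2 (+) x y ! i = K1"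
        using R_D(3)[OF x X] R_D(3)[OF y X] nth[OF class_less[OF X(2,1)]]
        by (metis add_0 add_0_right klein_add_self)
    next
      fix X assume X: "X \<in> N // r"
      have "(\<Sum>i\<in>X. map2 (+) x y ! i) = (\<Sum>i\<in>X. x ! i + y ! i)"
        by (rule sum.cong[OF refl nth[OF class_less[OF _ X]]])
      then show "(\<Sum>i\<in>X. map2 (+) x y ! i) = 0"
        by (simp add: sum.distrib R_D(4)[OF x X] R_D(4)[OF y X])
    qed
  qed (simp add: R_def)
  have gens: "{x \<in> C. ewt x \<le> 2} \<subseteq> R"
  proof
    fix x assume "x \<in> {x \<in> C. ewt x \<le> 2}"
    then have x: "x \<in> C" "ewt x \<le> 2" "length x = n" using L_code_length[OF C(1)] by auto
    from x(2,3) show "x \<in> R"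
    proof (cases rule: ewt_le_2_cases)
      case zero
      then show ?thesis using L_code_zero[OF R_code] by simp
    next
      case (K1 i)
      then show ?thesis using no_K1 x by simp
    next
      case (norm2 i b)
      then have "i \<in> A" using x by (auto simp: A_def norm2_eq_2_iff)
      then have "x ! k = 0" if "X \<in> N // r" "k \<in> X" for k X
        using that classes(1)[of X] norm2 by (auto simp: N_def subset_iff)
      then show ?thesis using nth_A[OF x(1)] x(3) by (intro R_I sum.neutral) auto
    next
      case (pair i j)
      have nth: "x ! k = (if k = i then K1 else 0) + (if k = j then K1 else 0)" if "k < n" for k
        using that pair by simp
      have "x ! i = K1" "x ! j = K1" using pair by simp_all
      \<comment> \<open>On \<open>A\<close> a codeword only has entries \<open>0\<close> and
        \<open>a k\<close>, so the two entries \<open>K1\<close> lie outside \<open>A\<close>. Hence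
        \<open>i\<close> and \<open>j\<close> are related, every class contains both or neither, and
        its sum vanishes.\<close>
      moreover have "a k \<noteq> K1" "K1 \<noteq> 0" for k by (simp_all add: a_def zero_prod_def)
      ultimately have "i \<notin> A" "j \<notin> A"
        using nth_A[OF x(1)] by metis+
      then have "(i, j) \<in> r" using pair x by (auto simp: r_def N_def)
      have "(\<Sum>k\<in>X. x ! k) = 0" if X: "X \<in> N // r" for X
      proof -
        have "(\<Sum>k\<in>X. x ! k) = (\<Sum>k\<in>X. (if k = i then K1 else 0) + (if k = j then K1 else 0))"
          using nth[OF class_less[OF _ X]] by (intro sum.cong refl)
        also have "\<dots> = (if i \<in> X then K1 else 0) + (if j \<in> X then K1 else 0)"
          using classes(3)[OF X] by (simp add: sum.distrib)
        also have "\<dots> = 0"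
          using same_class[OF X \<open>(i, j) \<in> r\<close>] by simp
        finally show ?thesis .
      qed
      moreover have "x ! k = 0 \<or> x ! k = K1" if "X \<in> N // r" "k \<in> X" for X k
        using nth[OF class_less[OF that(2,1)]] pair(3) by auto
      ultimately show ?thesis using nth_A[OF x(1)] x(3) by (intro R_I)
    qed
  qed
  have gens_carrier: "{x \<in> C. ewt x \<le> 2} \<subseteq> carrier (Lpow n)"
    using L_code_length[OF C(1)] by auto
  have W_code: "L_code n W"
    unfolding L_code_def W_def weight2_subcode_def
    by (rule group.generate_is_subgroup[OF group_Lpow gens_carrier])
  have "W \<subseteq> R"
    using group.generate_subgroup_incl[OF group_Lpow gens] R_code
    by (simp add: W_def weight2_subcode_def L_code_def)
  moreover have W_gen: "x \<in> W" if "x \<in> C" "ewt x \<le> 2" for x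
    using that by (auto simp: W_def weight2_subcode_def intro: generate.incl)
  have "R \<subseteq> W"
  proof (rule subset_L_code_if_descent[OF W_code])
    fix x i assume x: "x \<in> R" "i < n" "x ! i \<noteq> 0"
    have "\<exists>g\<in>W. supp (map2 (+) x g) \<subset> supp x"
    proof (cases "i \<in> A")
      case True
      then have "unit_vec n i (a i) \<in> W"
        using a(2) norm2_le_2 x(2) by (intro W_gen) (auto simp: ewt_unit_vec)
      then show ?thesis
        using x True by (intro bexI[of _ "unit_vec n i (a i)"] supp_add_psubset[of _ n _ i])
          (auto simp: R_D(1) A_def split: if_splits dest: R_D(2))
    next
      case False
      then obtain X where X: "X \<in> N // r" "i \<in> X"
        using in_class[of i] x(2) by (auto simp: N_def)
      \<comment> \<open>The sum over the class of \<open>i\<close> is zero, so a nonzero entry at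
        \<open>i\<close> forces a second one at some \<open>j\<close> in the class; both are
        \<open>K1\<close> and are cancelled together by \<open>pair_vec n i j\<close>.\<close>
      have "(\<Sum>k\<in>X. x ! k) = x ! i + (\<Sum>k\<in>X - {i}. x ! k)"
        using X classes(3) by (intro sum.remove) auto
      then have "(\<Sum>k\<in>X - {i}. x ! k) \<noteq> 0"
        using x(3) R_D(4)[OF x(1) X(1)] by auto
      then obtain j where j: "j \<in> X" "j \<noteq> i" "x ! j \<noteq> 0"
        by (metis DiffE singletonI sum.neutral)
      have ij: "j < n" "pair_vec n i j \<in> C"
        using in_quotient_imp_in_rel[OF equiv X(1), of i j] X(2) j by (auto simp: r_def N_def)
      have "pair_vec n i j \<in> W"
        using ij x(2) j(2) by (intro W_gen) (simp_all add: ewt_pair_vec)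
      then show ?thesis
        using x j ij R_D(1)[OF x(1)] R_D(3)[OF x(1) X] R_D(3)[OF x(1) X(1) j(1)]
        by (intro bexI[of _ "pair_vec n i j"] supp_add_psubset[of _ n _ i])
          (auto split: if_splits)
    qed
    then show "\<exists>g\<in>W. map2 (+) x g \<in> R \<and> supp (map2 (+) x g) \<subset> supp x"
      using \<open>W \<subseteq> R\<close> x(1) L_code_add[OF R_code] by blast
  qed (simp add: R_def)
  ultimately have W_eq: "W = R" by blast
  have "finite (N // r)"
    by (rule finite_quotient) (auto simp: N_def r_def)
  then obtain Xs where Xs: "set Xs = N // r" "distinct Xs"
    using finite_distinct_list by blast
  define As where "As = sorted_list_of_set A"
  have As: "distinct As" "set As = A" by (simp_all add: As_def A_def)
  define Bs where "Bs = map sorted_list_of_set Xs @ map (\<lambda>i. [i]) As"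
  define Ds where "Ds = map (\<lambda>X. Delta (card X)) Xs @ map (\<lambda>_. Xi1) As"
  have "equivalent_codes n W (dsum_list Ds)"
  proof (rule equivalent_codes_dsum_listI[where T = T and Bs = Bs])
    show "set (concat Bs) = {..<n}"
      using Xs Union_quotient[OF equiv] classes(3) As by (auto simp: Bs_def N_def A_def)
    have "distinct (concat (map sorted_list_of_set Xs))"
    proof (rule distinct_concat)
      show "distinct (map sorted_list_of_set Xs)"
        using Xs classes(3) by (auto simp: distinct_map inj_on_def sorted_list_of_set_inject)
      fix ys zs
      assume "ys \<in> set (map sorted_list_of_set Xs)" "zs \<in> set (map sorted_list_of_set Xs)" "ys \<noteq> zs"
      then obtain X Y where "X \<in> N // r" "Y \<in> N // r" "X \<noteq> Y"
          "ys = sorted_list_of_set X" "zs = sorted_list_of_set Y"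
        using Xs(1) by auto
      then show "set ys \<inter> set zs = {}"
        using quotient_disj[OF equiv] classes(3) by auto
    qed auto
    moreover have "set (concat (map sorted_list_of_set Xs)) \<inter> A = {}"
      using Xs(1) classes(1,3) by (fastforce simp: N_def)
    ultimately show "distinct (concat Bs)"
      using As by (simp add: Bs_def concat_map_singleton)
    show "list_all2 (\<lambda>B E. \<forall>y\<in>E. length y = length B) Bs Ds"
      by (auto simp: Bs_def Ds_def list_all2_append list_all2_map1 list_all2_map2 list_all2_same
          Delta_def Xi1_def)
    fix x
    have *: "map (\<lambda>j. if j \<in> T then interchange (x ! j) else x ! j) (sorted_list_of_set X) \<in>
        Delta (card X) \<longleftrightarrow> (\<forall>i\<in>X. x ! i \<in> {0, K1}) \<and> (\<Sum>i\<in>X. x ! i) = 0" if X: "X \<in> N // r" for X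
    proof -
      \<comment> \<open>\<open>T\<close> lies inside \<open>A\<close>, so nothing is interchanged on
        the blocks that come from classes.\<close>
      have "X \<inter> T = {}" using classes(1)[OF X] by (auto simp: N_def A_def T_def)
      then have "map (\<lambda>j. if j \<in> T then interchange (x ! j) else x ! j) (sorted_list_of_set X) =
          map ((!) x) (sorted_list_of_set X)"
        using classes(3)[OF X] by (intro map_cong) auto
      then show ?thesis
        using in_Delta_iff[of "sorted_list_of_set X" "(!) x"] classes(3)[OF X]
        by (simp del: map_eq_conv)
    qed
    have **: "[if i \<in> T then interchange (x ! i) else x ! i] \<in> Xi1 \<longleftrightarrow> x ! i \<in> {0, a i}" for i
      by (auto simp: Xi1_def a_def interchange_def zero_prod_def)
    show "x \<in> W \<longleftrightarrow> length x = n \<and>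
      list_all2 (\<lambda>B E. map (\<lambda>j. if j \<in> T then interchange (x ! j) else x ! j) B \<in> E) Bs Ds"
      unfolding W_eq Bs_def Ds_def
      using * ** Xs As
      by (auto simp: list_all2_append list_all2_map1 list_all2_map2 list_all2_same R_def)
  qed
  moreover have "\<forall>E\<in>set Ds. (\<exists>l\<ge>1. E = Delta l) \<or> E = Xi1"
  proof -
    \<comment> \<open>Equivalence classes are nonempty, which gives the bound
      \<open>l \<ge> 1\<close>.\<close>
    have "card X \<ge> 1" if "X \<in> N // r" for X
      using classes(2,3)[OF that] by (simp add: Suc_le_eq card_gt_0_iff)
    then show ?thesis using Xs by (auto simp: Ds_def)
  qed
  ultimately show thesis using that by (simp add: W_def)
qed

theorem theorem4p7:
  fixes n :: nat and C :: "klein list set"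
  assumes "L_code n C" and "self_orthogonal C"
  shows "(\<exists>l m D. L_code m D \<and> min_ewt m D > 1 \<and>
            equivalent_codes n C (D \<oplus>\<^sub>L dsum_pow Gamma1 l)) \<and>
         (min_ewt n C = 2 \<longrightarrow>
            (\<exists>Ds. (\<forall>E\<in>set Ds. (\<exists>l\<ge>1. E = Delta l) \<or> E = Xi1) \<and>
               equivalent_codes n (weight2_subcode n C) (dsum_list Ds)))"
  using self_orthogonal_split_Gamma1[OF assms] weight2_subcode_equivalent_dsum_list[OF assms]
  by metis

end
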